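(* Let $G\le\mathrm{Sym}(n)$ be a $2$-transitive permutation group and assume: (a) $G$ has the EKR property; (b) for every intersecting subset $S\subseteq G$ of maximum size, the characteristic vector $v_S\in\mathbb{C}^G$ lies in the direct sum of the trivial module and the standard module of $G$; and (c) the matrix $M$ for $G$ has full rank (rank $(n-1)(n-2)$, i.e. linearly independent columns). Then $G$ has the strict EKR property.
   Context: $G$ acts naturally on $[n]$. $\pi,\sigma\in G$ intersect if $\pi\sigma^{-1}$ fixes a point of $[n]$; a subset is intersecting if every pair of its elements intersect. $G$ has the EKR property if every intersecting subset has size at most the size of the largest point-stabilizer, and the strict EKR property if moreover every maximum-size intersecting subset is of the form $\{\pi\in G:\pi(i)=j\}$ for some $i,j\in[n]$. For an irreducible character $\chi$ of $G$, let $E_\chi$ be the $G\times G$ matrix with $(E_\chi)_{\pi,\sigma}=\frac{\chi(1)}{|G|}\chi(\pi^{-1}\sigma)$; the $\chi$-module is the column space of $E_\chi$ in $\mathbb{C}^G$. The trivial module is the module of the trivial character, and the standard module is the module of the standard character $\chi(g)=|\mathrm{fix}(g)|-1$ (irreducible since $G$ is $2$-transitive). For $S\subseteq G$, $v_S$ is its characteristic vector. The matrix $M$ for $G$ has rows indexed by the derangements of $G$ (elements with no fixed point in $[n]$) and columns indexed by ordered pairs $(i,j)$ with $i,j\in[n-1]$, $i\ne j$; its $(\sigma,(i,j))$ entry is $1$ if $\sigma(i)=j$ and $0$ otherwise. *)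

theory Defs
  imports Complex_Main "HOL-Algebra.Sym_Groups" "HOL-Library.Function_Algebras"
begin

text \<open>
  A permutation group of degree n is a subgroup of \<^const>\<open>sym_group\<close> n, given by its carrier
  \<open>G :: (nat \<Rightarrow> nat) set\<close>; its elements permute \<open>{1..n}\<close> and fix every other natural number.
\<close>

text \<open>
  The condition \<open>2 \<le> n\<close> excludes the degenerate degrees, where the action is vacuously transitive
  on ordered pairs of distinct points but the standard character is not a character (n = 0) or is
  zero (n = 1).
\<close>

definition two_transitive :: "nat \<Rightarrow> (nat \<Rightarrow> nat) set \<Rightarrow> bool" where
  "two_transitive n G \<longleftrightarrow> 2 \<le> n \<and>
     (\<forall>i\<in>{1..n}. \<forall>j\<in>{1..n}. \<forall>k\<in>{1..n}. \<forall>l\<in>{1..n}. i \<noteq> j \<longrightarrow> k \<noteq> l \<longrightarrow>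
        (\<exists>\<pi>\<in>G. \<pi> i = k \<and> \<pi> j = l))"

definition perms_intersect :: "nat \<Rightarrow> (nat \<Rightarrow> nat) \<Rightarrow> (nat \<Rightarrow> nat) \<Rightarrow> bool" where
  "perms_intersect n \<pi> \<sigma> \<longleftrightarrow> (\<exists>i\<in>{1..n}. (\<pi> \<circ> inv' \<sigma>) i = i)"

definition intersecting_subset :: "nat \<Rightarrow> (nat \<Rightarrow> nat) set \<Rightarrow> (nat \<Rightarrow> nat) set \<Rightarrow> bool" where
  "intersecting_subset n G S \<longleftrightarrow> S \<subseteq> G \<and> (\<forall>\<pi>\<in>S. \<forall>\<sigma>\<in>S. perms_intersect n \<pi> \<sigma>)"

definition maximum_intersecting_subset ::
    "nat \<Rightarrow> (nat \<Rightarrow> nat) set \<Rightarrow> (nat \<Rightarrow> nat) set \<Rightarrow> bool" where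
  "maximum_intersecting_subset n G S \<longleftrightarrow>
     intersecting_subset n G S \<and> (\<forall>T. intersecting_subset n G T \<longrightarrow> card T \<le> card S)"

definition point_stabilizer :: "(nat \<Rightarrow> nat) set \<Rightarrow> nat \<Rightarrow> (nat \<Rightarrow> nat) set" where
  "point_stabilizer G i = {\<pi>\<in>G. \<pi> i = i}"

definition EKR_property :: "nat \<Rightarrow> (nat \<Rightarrow> nat) set \<Rightarrow> bool" where
  "EKR_property n G \<longleftrightarrow>
     (\<forall>S. intersecting_subset n G S \<longrightarrow> card S \<le> Max ((\<lambda>i. card (point_stabilizer G i)) ` {1..n}))"

definition strict_EKR_property :: "nat \<Rightarrow> (nat \<Rightarrow> nat) set \<Rightarrow> bool" where
  "strict_EKR_property n G \<longleftrightarrow> EKR_property n G \<and>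
     (\<forall>S. maximum_intersecting_subset n G S \<longrightarrow>
        (\<exists>i\<in>{1..n}. \<exists>j\<in>{1..n}. S = {\<pi>\<in>G. \<pi> i = j}))"

definition cfun_scale :: "complex \<Rightarrow> ('a \<Rightarrow> complex) \<Rightarrow> 'a \<Rightarrow> complex" where
  "cfun_scale c f = (\<lambda>x. c * f x)"

global_interpretation cfun: vector_space "cfun_scale :: complex \<Rightarrow> ('a \<Rightarrow> complex) \<Rightarrow> 'a \<Rightarrow> complex"
  by unfold_locales (auto simp: cfun_scale_def fun_eq_iff algebra_simps)

text \<open>
  For a set R, the vector space of R-indexed complex vectors is modelled by the functions
  \<open>'r \<Rightarrow> complex\<close> that vanish outside R. A matrix with row set R and column set C is a function
  \<open>A :: 'r \<Rightarrow> 'c \<Rightarrow> complex\<close>, of which only the values on R and C matter.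
\<close>

definition matrix_column :: "'r set \<Rightarrow> ('r \<Rightarrow> 'c \<Rightarrow> complex) \<Rightarrow> 'c \<Rightarrow> 'r \<Rightarrow> complex" where
  "matrix_column R A c = (\<lambda>r. if r \<in> R then A r c else 0)"

definition column_space :: "'r set \<Rightarrow> 'c set \<Rightarrow> ('r \<Rightarrow> 'c \<Rightarrow> complex) \<Rightarrow> ('r \<Rightarrow> complex) set" where
  "column_space R C A = cfun.span (matrix_column R A ` C)"

definition matrix_rank :: "'r set \<Rightarrow> 'c set \<Rightarrow> ('r \<Rightarrow> 'c \<Rightarrow> complex) \<Rightarrow> nat" where
  "matrix_rank R C A = cfun.dim (column_space R C A)"

definition E_matrix ::
    "(nat \<Rightarrow> nat) set \<Rightarrow> ((nat \<Rightarrow> nat) \<Rightarrow> complex) \<Rightarrow> (nat \<Rightarrow> nat) \<Rightarrow> (nat \<Rightarrow> nat) \<Rightarrow> complex" where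
  "E_matrix G \<chi> \<pi> \<sigma> = \<chi> id / of_nat (card G) * \<chi> (inv' \<pi> \<circ> \<sigma>)"

definition character_module ::
    "(nat \<Rightarrow> nat) set \<Rightarrow> ((nat \<Rightarrow> nat) \<Rightarrow> complex) \<Rightarrow> ((nat \<Rightarrow> nat) \<Rightarrow> complex) set" where
  "character_module G \<chi> = column_space G G (E_matrix G \<chi>)"

definition trivial_character :: "(nat \<Rightarrow> nat) \<Rightarrow> complex" where
  "trivial_character g = 1"

definition standard_character :: "nat \<Rightarrow> (nat \<Rightarrow> nat) \<Rightarrow> complex" where
  "standard_character n g = of_nat (card {i\<in>{1..n}. g i = i}) - 1"

definition trivial_module :: "(nat \<Rightarrow> nat) set \<Rightarrow> ((nat \<Rightarrow> nat) \<Rightarrow> complex) set" where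
  "trivial_module G = character_module G trivial_character"

definition standard_module :: "nat \<Rightarrow> (nat \<Rightarrow> nat) set \<Rightarrow> ((nat \<Rightarrow> nat) \<Rightarrow> complex) set" where
  "standard_module n G = character_module G (standard_character n)"

text \<open>
  For a 2-transitive group the two summands meet only in 0, being the modules of two different
  irreducible characters, so that this sum of subspaces is direct.
\<close>

definition trivial_plus_standard_module ::
    "nat \<Rightarrow> (nat \<Rightarrow> nat) set \<Rightarrow> ((nat \<Rightarrow> nat) \<Rightarrow> complex) set" where
  "trivial_plus_standard_module n G =
     {u + w | u w. u \<in> trivial_module G \<and> w \<in> standard_module n G}"

definition characteristic_vector :: "(nat \<Rightarrow> nat) set \<Rightarrow> (nat \<Rightarrow> nat) \<Rightarrow> complex" where
  "characteristic_vector S = (\<lambda>\<pi>. if \<pi> \<in> S then 1 else 0)"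

definition derangements :: "nat \<Rightarrow> (nat \<Rightarrow> nat) set \<Rightarrow> (nat \<Rightarrow> nat) set" where
  "derangements n G = {\<sigma>\<in>G. \<forall>i\<in>{1..n}. \<sigma> i \<noteq> i}"

definition M_columns :: "nat \<Rightarrow> (nat \<times> nat) set" where
  "M_columns n = {(i, j). i \<in> {1..n - 1} \<and> j \<in> {1..n - 1} \<and> i \<noteq> j}"

definition M_matrix :: "(nat \<Rightarrow> nat) \<Rightarrow> nat \<times> nat \<Rightarrow> complex" where
  "M_matrix \<sigma> = (\<lambda>(i, j). if \<sigma> i = j then 1 else 0)"

end

theory Submission
  imports Defs
begin

text \<open>
  The trivial and the standard module consist of functions \<open>\<pi> \<mapsto> \<Sum>i. a i (\<pi> i)\<close>. Adding to \<open>a\<close>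
  terms that depend only on \<open>i\<close> or only on \<open>j\<close> and have total 0 does not change the function, which
  for \<open>n \<ge> 3\<close> allows clearing the last row and column of \<open>a\<close> off the diagonal. After a translation,
  a maximum intersecting set S contains the identity and hence no derangement; evaluating \<open>v\<^sub>S\<close> at
  derangements, the full rank of M then clears all off-diagonal entries. So \<open>v\<^sub>S(\<pi>)\<close> is the sum of
  the diagonal entries over the fixed points of \<open>\<pi>\<close>. By Jordan's theorem, applied to a point
  stabilizer on the remaining points, each \<open>i\<close> is the only fixed point of some element, so each
  diagonal entry is 0 or 1. Their sum is \<open>v\<^sub>S(id) = 1\<close>, so exactly one of them is 1.
\<close>

section \<open>Linear algebra\<close>

lemma sum_fun_apply:
  "(\<Sum>i\<in>I. f i) x = (\<Sum>i\<in>I. f i x)" for f :: "'i \<Rightarrow> 'a \<Rightarrow> complex"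
  by (induction I rule: infinite_finite_induct) auto

text \<open>A nonzero \<open>c k\<close> would put column \<open>k\<close> in the span of the
  others, so that \<open>card C - 1\<close> vectors would span the column space. The count is by
  indices, so coinciding columns are covered too.\<close>

lemma full_rank_columns_independent:
  assumes fin: "finite C" and rank: "matrix_rank R C A = card C"
    and zero: "\<And>r. r \<in> R \<Longrightarrow> (\<Sum>k\<in>C. c k * A r k) = 0" and k: "k \<in> C"
  shows "c k = 0"
proof (rule ccontr)
  assume ck: "c k \<noteq> 0"
  let ?col = "matrix_column R A"
  have "?col k r = (\<Sum>l\<in>C - {k}. cfun_scale (- c l / c k) (?col l)) r" for r
  proof (cases "r \<in> R")
    case True
    have "c k * A r k + (\<Sum>l\<in>C - {k}. c l * A r l) = 0"
      using zero[OF True] sum.remove[OF fin k, of "\<lambda>l. c l * A r l"] by simp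
    then have "A r k = - (\<Sum>l\<in>C - {k}. c l * A r l) / c k"
      using ck by (simp add: field_simps eq_neg_iff_add_eq_0)
    then show ?thesis
      using True
      by (simp add: sum_fun_apply cfun_scale_def matrix_column_def sum_negf sum_divide_distrib)
  qed (simp add: sum_fun_apply cfun_scale_def matrix_column_def)
  then have "?col k = (\<Sum>l\<in>C - {k}. cfun_scale (- c l / c k) (?col l))"
    by blast
  moreover have "\<dots> \<in> cfun.span (?col ` (C - {k}))"
    by (intro cfun.span_sum cfun.span_scale cfun.span_base) auto
  ultimately have "?col k \<in> cfun.span (?col ` (C - {k}))"
    by simp
  then have "?col ` C \<subseteq> cfun.span (?col ` (C - {k}))"
    using cfun.span_superset[of "?col ` (C - {k})"] by auto
  then have "column_space R C A \<subseteq> cfun.span (?col ` (C - {k}))"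
    unfolding column_space_def by (rule cfun.span_minimal) (rule cfun.subspace_span)
  then have "matrix_rank R C A \<le> card (?col ` (C - {k}))"
    unfolding matrix_rank_def using fin by (intro cfun.dim_le_card) auto
  also have "\<dots> \<le> card (C - {k})"
    using fin by (intro card_image_le) auto
  also have "\<dots> < card C"
    using fin k by (rule card_Diff1_less)
  finally show False
    using rank by simp
qed

lemma finite_M_columns: "finite (M_columns n)"
  by (rule finite_subset[of _ "{1..n-1} \<times> {1..n-1}"]) (auto simp: M_columns_def)

lemma card_M_columns: "card (M_columns n) = (n - 1) * (n - 2)"
proof -
  have "M_columns n = (SIGMA i:{1..n-1}. {1..n-1} - {i})"
    by (auto simp: M_columns_def)
  also have "card \<dots> = (\<Sum>i\<in>{1..n-1}. card ({1..n-1} - {i}))"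
    by (rule card_SigmaI) auto
  also have "\<dots> = (\<Sum>i\<in>{1..n-1}. n - 2)"
    by (intro sum.cong) (auto simp: card_Diff_singleton)
  finally show ?thesis
    by simp
qed

section \<open>Functions in the trivial plus standard module\<close>

text \<open>For permutations of \<open>{1..n}\<close> this is the span of the indicators of the sets
  \<open>{\<pi>\<in>G. \<pi> i = j}\<close>. Values outside \<open>G\<close> are left free, so
  membership is a condition on \<open>G\<close> alone.\<close>

definition position_sums :: "nat \<Rightarrow> (nat \<Rightarrow> nat) set \<Rightarrow> ((nat \<Rightarrow> nat) \<Rightarrow> complex) set" where
  "position_sums n G = {f. \<exists>a. \<forall>\<pi>\<in>G. f \<pi> = (\<Sum>i\<in>{1..n}. a i (\<pi> i))}"

lemma subspace_position_sums: "cfun.subspace (position_sums n G)"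
proof (rule cfun.subspaceI)
  show "0 \<in> position_sums n G"
    by (auto simp: position_sums_def intro!: exI[of _ "\<lambda>_ _. 0"])
next
  fix f g assume "f \<in> position_sums n G" "g \<in> position_sums n G"
  then obtain a b where
    "\<forall>\<pi>\<in>G. f \<pi> = (\<Sum>i\<in>{1..n}. a i (\<pi> i))" "\<forall>\<pi>\<in>G. g \<pi> = (\<Sum>i\<in>{1..n}. b i (\<pi> i))"
    by (auto simp: position_sums_def)
  then show "f + g \<in> position_sums n G"
    by (auto simp: position_sums_def sum.distrib intro!: exI[of _ "\<lambda>i j. a i j + b i j"])
next
  fix c f assume "f \<in> position_sums n G"
  then obtain a where "\<forall>\<pi>\<in>G. f \<pi> = (\<Sum>i\<in>{1..n}. a i (\<pi> i))"
    by (auto simp: position_sums_def)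
  then show "cfun_scale c f \<in> position_sums n G"
    by (auto simp: position_sums_def cfun_scale_def sum_distrib_left
        intro!: exI[of _ "\<lambda>i j. c * a i j"])
qed

text \<open>The columns of \<open>E_matrix\<close> generate the module, and on \<open>G\<close>
  column \<sigma> is a multiple of the function in the premise. Since \<open>position_sums\<close>
  is a subspace, the generators suffice.\<close>

lemma character_module_subset_position_sums:
  assumes "\<And>\<sigma>. \<sigma> \<in> G \<Longrightarrow> \<exists>a. \<forall>\<pi>\<in>G. \<chi> (inv' \<pi> \<circ> \<sigma>) = (\<Sum>i\<in>{1..n}. a i (\<pi> i))"
  shows "character_module G \<chi> \<subseteq> position_sums n G"
  unfolding character_module_def column_space_def
proof (rule cfun.span_minimal[OF _ subspace_position_sums], clarify)
  fix \<sigma> assume "\<sigma> \<in> G"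
  then obtain a where a: "\<forall>\<pi>\<in>G. \<chi> (inv' \<pi> \<circ> \<sigma>) = (\<Sum>i\<in>{1..n}. a i (\<pi> i))"
    using assms by blast
  show "matrix_column G (E_matrix G \<chi>) \<sigma> \<in> position_sums n G"
    unfolding position_sums_def mem_Collect_eq
    by (rule exI[of _ "\<lambda>i j. \<chi> id / of_nat (card G) * a i j"])
      (use a in \<open>simp add: matrix_column_def E_matrix_def sum_distrib_left\<close>)
qed

lemma trivial_module_subset_position_sums:
  assumes "1 \<le> n"
  shows "trivial_module G \<subseteq> position_sums n G"
  unfolding trivial_module_def
proof (rule character_module_subset_position_sums)
  show "\<exists>a. \<forall>\<pi>\<in>G. trivial_character (inv' \<pi> \<circ> \<sigma>) = (\<Sum>i\<in>{1..n}. a i (\<pi> i))" for \<sigma>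
    \<comment> \<open>The constant 1 is split evenly among the \<open>n\<close> positions.\<close>
    by (rule exI[of _ "\<lambda>_ _. 1 / of_nat n"]) (use assms in \<open>simp add: trivial_character_def\<close>)
qed

text \<open>The fixed points of \<open>inv' \<pi> \<circ> \<sigma>\<close> are the points where
  \<pi> and \<sigma> agree, and agreement is tested position by position. The -1 in the standard
  character is spread as \<open>- 1 / n\<close> over the positions.\<close>

lemma standard_module_subset_position_sums:
  assumes n: "1 \<le> n" and perm: "\<And>\<pi>. \<pi> \<in> G \<Longrightarrow> \<pi> permutes {1..n}"
  shows "standard_module n G \<subseteq> position_sums n G"
  unfolding standard_module_def
proof (rule character_module_subset_position_sums)
  fix \<sigma>
  have "standard_character n (inv' \<pi> \<circ> \<sigma>)
      = (\<Sum>i\<in>{1..n}. (if \<sigma> i = \<pi> i then 1 else 0) - 1 / of_nat n)" if "\<pi> \<in> G" for \<pi>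
  proof -
    have "{i\<in>{1..n}. (inv' \<pi> \<circ> \<sigma>) i = i} = {i\<in>{1..n}. \<sigma> i = \<pi> i}"
      using perm[OF that] by (auto simp: permutes_inverses permutes_inv_eq)
    moreover have "(\<Sum>i\<in>{1..n}. if \<sigma> i = \<pi> i then 1 else 0 :: complex)
        = of_nat (card {i\<in>{1..n}. \<sigma> i = \<pi> i})"
      by (simp add: sum.If_cases Int_def)
    ultimately show ?thesis
      using n by (simp add: standard_character_def sum_subtractf)
  qed
  then show "\<exists>a. \<forall>\<pi>\<in>G. standard_character n (inv' \<pi> \<circ> \<sigma>) = (\<Sum>i\<in>{1..n}. a i (\<pi> i))"
    by (intro exI[of _ "\<lambda>i j. (if \<sigma> i = j then 1 else 0) - 1 / of_nat n"]) blast
qed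

lemma trivial_plus_standard_module_subset_position_sums:
  assumes "1 \<le> n" and "\<And>\<pi>. \<pi> \<in> G \<Longrightarrow> \<pi> permutes {1..n}"
  shows "trivial_plus_standard_module n G \<subseteq> position_sums n G"
  unfolding trivial_plus_standard_module_def
  using trivial_module_subset_position_sums[OF assms(1)]
    standard_module_subset_position_sums[OF assms]
    cfun.subspace_add[OF subspace_position_sums] by blast

lemma position_sum_normal_form:
  fixes a :: "nat \<Rightarrow> nat \<Rightarrow> complex"
  assumes n: "3 \<le> n"
  obtains b where
    "\<And>\<pi>. \<pi> permutes {1..n} \<Longrightarrow> (\<Sum>i\<in>{1..n}. b i (\<pi> i)) = (\<Sum>i\<in>{1..n}. a i (\<pi> i))"
    and "\<And>i. i \<noteq> n \<Longrightarrow> b i n = 0" and "\<And>j. j \<noteq> n \<Longrightarrow> b n j = 0"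
proof -
  \<comment> \<open>Clearing the last column with \<open>s n = 0\<close> forces
    \<open>r i = a i n\<close> for \<open>i \<noteq> n\<close>; clearing the last row forces
    \<open>s j = a n j - r n\<close>. The remaining parameter \<open>t = r n\<close> enters the
    total of \<open>r\<close> and \<open>s\<close> with coefficient
    \<open>1 - (n - 1) = - (n - 2)\<close>, so for \<open>n \<ge> 3\<close> it can be chosen to make
    that total 0.\<close>
  define t where "t = ((\<Sum>i\<in>{1..n-1}. a i n) + (\<Sum>j\<in>{1..n-1}. a n j)) / of_nat (n - 2)"
  define r where "r i = (if i = n then t else a i n)" for i
  define s where "s j = (if j = n then 0 else a n j - t)" for j
  have split: "{1..n} = insert n {1..n-1}"
    using n by auto
  have nn: "n \<notin> {1..n-1}"
    using n by auto
  have r: "sum r {1..n} = t + (\<Sum>i\<in>{1..n-1}. a i n)"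
  proof -
    have "sum r {1..n-1} = (\<Sum>i\<in>{1..n-1}. a i n)"
      using nn by (intro sum.cong) (auto simp: r_def)
    then show ?thesis
      unfolding split using nn by (simp add: r_def)
  qed
  have s: "sum s {1..n} = (\<Sum>j\<in>{1..n-1}. a n j) - of_nat (n - 1) * t"
  proof -
    have "sum s {1..n-1} = (\<Sum>j\<in>{1..n-1}. a n j - t)"
      using nn by (intro sum.cong) (auto simp: s_def)
    then show ?thesis
      unfolding split using nn by (simp add: s_def sum_subtractf)
  qed
  have "of_nat (n - 2) * t = (\<Sum>i\<in>{1..n-1}. a i n) + (\<Sum>j\<in>{1..n-1}. a n j)"
    using n by (simp add: t_def del: of_nat_diff)
  moreover have "of_nat (n - 1) = (of_nat (n - 2) + 1 :: complex)"
    using n by (simp add: of_nat_diff)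
  ultimately have total: "sum r {1..n} + sum s {1..n} = 0"
    unfolding r s by (simp add: algebra_simps)
  show ?thesis
  proof (rule that[of "\<lambda>i j. a i j - r i - s j"])
    fix \<pi> :: "nat \<Rightarrow> nat" assume "\<pi> permutes {1..n}"
    then have "(\<Sum>i\<in>{1..n}. s (\<pi> i)) = sum s {1..n}"
      using sum.permute[of \<pi> "{1..n}" s] by (simp add: o_def)
    then show "(\<Sum>i\<in>{1..n}. a i (\<pi> i) - r i - s (\<pi> i)) = (\<Sum>i\<in>{1..n}. a i (\<pi> i))"
      using total by (simp add: sum_subtractf diff_diff_eq sum.distrib)
  qed (auto simp: r_def s_def)
qed

section \<open>Elements with a single fixed point\<close>

text \<open>Jordan's theorem by counting. By transitivity a point stabilizer has at most
  \<open>card H / card X\<close> elements, so there are at most \<open>card H\<close> pairs of an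
  element and a fixed point of it. If every element had a fixed point, the identity with its at
  least two would push the count above \<open>card H\<close>.\<close>

lemma transitive_exists_derangement:
  fixes H :: "('a \<Rightarrow> 'a) set"
  assumes fin: "finite H" and idH: "id \<in> H"
    and comp: "\<And>g h. g \<in> H \<Longrightarrow> h \<in> H \<Longrightarrow> g \<circ> h \<in> H"
    and inj: "\<And>g. g \<in> H \<Longrightarrow> inj g"
    and maps: "\<And>g x. g \<in> H \<Longrightarrow> x \<in> X \<Longrightarrow> g x \<in> X"
    and trans: "\<And>x y. x \<in> X \<Longrightarrow> y \<in> X \<Longrightarrow> \<exists>g\<in>H. g x = y"
    and X: "finite X" "2 \<le> card X"
  shows "\<exists>g\<in>H. \<forall>x\<in>X. g x \<noteq> x"
proof (rule ccontr)
  assume "\<not> ?thesis"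
  then have fixpt: "\<exists>x\<in>X. g x = x" if "g \<in> H" for g
    using that by blast
  have stab: "card X * card {h\<in>H. h x = x} \<le> card H" if x: "x \<in> X" for x
  proof -
    \<comment> \<open>Left multiplication by an element taking \<open>x\<close> to \<open>y\<close>
      injects the stabilizer of \<open>x\<close> into the set of elements taking \<open>x\<close> to
      \<open>y\<close>. These sets are disjoint for different \<open>y\<close>.\<close>
    have le: "card {h\<in>H. h x = x} \<le> card {h\<in>H. h x = y}" if y: "y \<in> X" for y
    proof -
      obtain g where g: "g \<in> H" "g x = y"
        using trans[OF x y] by blast
      show ?thesis
      proof (rule card_inj_on_le[of "\<lambda>h. g \<circ> h"])
        show "inj_on (\<lambda>h. g \<circ> h) {h\<in>H. h x = x}"
          using inj[OF g(1)] by (auto simp: inj_on_def fun_eq_iff)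
      qed (use g comp fin in auto)
    qed
    have "card X * card {h\<in>H. h x = x} = (\<Sum>y\<in>X. card {h\<in>H. h x = x})"
      by simp
    also have "\<dots> \<le> (\<Sum>y\<in>X. card {h\<in>H. h x = y})"
      by (intro sum_mono le)
    also have "\<dots> = card (\<Union>y\<in>X. {h\<in>H. h x = y})"
      using fin X by (intro card_UN_disjoint[symmetric]) auto
    also have "\<dots> \<le> card H"
      using fin by (intro card_mono) auto
    finally show ?thesis .
  qed
  have "card H < (\<Sum>g\<in>H. card {x\<in>X. g x = x})"
  proof -
    have "(\<Sum>g\<in>H. 1) < (\<Sum>g\<in>H. card {x\<in>X. g x = x})"
    proof (rule sum_strict_mono_ex1[OF fin])
      show "\<forall>g\<in>H. 1 \<le> card {x\<in>X. g x = x}"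
      proof
        fix g assume "g \<in> H"
        then have "{x\<in>X. g x = x} \<noteq> {}"
          using fixpt by auto
        then show "1 \<le> card {x\<in>X. g x = x}"
          using X by (simp add: Suc_le_eq card_gt_0_iff)
      qed
      show "\<exists>g\<in>H. 1 < card {x\<in>X. g x = x}"
        using idH X by (intro bexI[of _ id]) auto
    qed
    then show ?thesis
      by simp
  qed
  \<comment> \<open>Double counting of the pairs \<open>(g, x)\<close> with
    \<open>g x = x\<close>.\<close>
  also have "(\<Sum>g\<in>H. card {x\<in>X. g x = x}) = (\<Sum>x\<in>X. card {g\<in>H. g x = x})"
    using sum_multicount_gen[OF fin X(1), of "\<lambda>g x. g x = x"] by simp
  finally have "card X * card H < (\<Sum>x\<in>X. card X * card {g\<in>H. g x = x})"
    using X by (simp add: sum_distrib_left[symmetric])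
  also have "\<dots> \<le> (\<Sum>x\<in>X. card H)"
    by (intro sum_mono stab)
  finally show False
    by simp
qed

text \<open>Moving \<open>(k, x)\<close> to \<open>(k, y)\<close> by 2-transitivity shows that the
  stabilizer of \<open>k\<close> is transitive on the other points, of which there are at least two.
  A derangement of those points in the stabilizer fixes only \<open>k\<close>.\<close>

lemma two_transitive_single_fixed_point:
  assumes fin: "finite G" and idG: "id \<in> G"
    and comp: "\<And>g h. g \<in> G \<Longrightarrow> h \<in> G \<Longrightarrow> g \<circ> h \<in> G"
    and perm: "\<And>g. g \<in> G \<Longrightarrow> g permutes {1..n}"
    and trans: "two_transitive n G" and n: "3 \<le> n" and k: "k \<in> {1..n}"
  obtains g where "g \<in> G" "{i\<in>{1..n}. g i = i} = {k}"
proof -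
  have "\<exists>g\<in>point_stabilizer G k. \<forall>x\<in>{1..n} - {k}. g x \<noteq> x"
  proof (rule transitive_exists_derangement)
    fix x y assume "x \<in> {1..n} - {k}" "y \<in> {1..n} - {k}"
    then show "\<exists>g\<in>point_stabilizer G k. g x = y"
      using trans k unfolding two_transitive_def point_stabilizer_def by blast
  next
    fix g x assume "g \<in> point_stabilizer G k" "x \<in> {1..n} - {k}"
    then have "g permutes {1..n}" "g k = k" "x \<in> {1..n}" "x \<noteq> k"
      using perm by (auto simp: point_stabilizer_def)
    then show "g x \<in> {1..n} - {k}"
      by (metis Diff_iff insertE empty_iff permutes_in_image permutes_inj inj_eq)
  next
    show "2 \<le> card ({1..n} - {k})"
      using n k by (simp add: card_Diff_singleton)
  qed (use fin idG comp perm in \<open>auto simp: point_stabilizer_def dest: permutes_inj\<close>)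
  then obtain g where "g \<in> G" "g k = k" "\<forall>x\<in>{1..n} - {k}. g x \<noteq> x"
    by (auto simp: point_stabilizer_def)
  then show ?thesis
    using k by (intro that[of g]) auto
qed

section \<open>Maximum intersecting sets\<close>

text \<open>\<open>T\<close> stands for a maximum intersecting set translated so that it contains
  the identity.\<close>

lemma position_sum_derangement_free_is_stabilizer:
  assumes fin: "finite G" and idG: "id \<in> G"
    and comp: "\<And>g h. g \<in> G \<Longrightarrow> h \<in> G \<Longrightarrow> g \<circ> h \<in> G"
    and perm: "\<And>g. g \<in> G \<Longrightarrow> g permutes {1..n}"
    and trans: "two_transitive n G" and n: "3 \<le> n"
    and rank: "matrix_rank (derangements n G) (M_columns n) M_matrix = (n - 1) * (n - 2)"
    and T: "T \<subseteq> G" "id \<in> T" "T \<inter> derangements n G = {}"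
    and v: "characteristic_vector T \<in> position_sums n G"
  obtains k where "k \<in> {1..n}" "T = point_stabilizer G k"
proof -
  obtain a where a: "\<forall>\<pi>\<in>G. characteristic_vector T \<pi> = (\<Sum>i\<in>{1..n}. a i (\<pi> i))"
    using v by (auto simp: position_sums_def)
  obtain b where
    ba: "\<And>\<pi>. \<pi> permutes {1..n} \<Longrightarrow> (\<Sum>i\<in>{1..n}. b i (\<pi> i)) = (\<Sum>i\<in>{1..n}. a i (\<pi> i))"
    and b_col: "\<And>i. i \<noteq> n \<Longrightarrow> b i n = 0" and b_row: "\<And>j. j \<noteq> n \<Longrightarrow> b n j = 0"
    using position_sum_normal_form[OF n] by metis
  have vT: "characteristic_vector T \<pi> = (\<Sum>i\<in>{1..n}. b i (\<pi> i))" if "\<pi> \<in> G" for \<pi>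
    using a ba perm that by simp
  \<comment> \<open>The entries of \<open>b\<close> at the index pairs of M are the coefficients of
    a linear relation among its columns.\<close>
  have zero: "(\<Sum>k\<in>M_columns n. (case k of (i, j) \<Rightarrow> b i j) * M_matrix d k) = 0"
    if d: "d \<in> derangements n G" for d
  proof -
    have dG: "d \<in> G" and d_neq: "\<And>i. i \<in> {1..n} \<Longrightarrow> d i \<noteq> i"
      using d by (auto simp: derangements_def)
    have dn: "d i \<in> {1..n}" if "i \<in> {1..n}" for i
      using perm[OF dG] that by (simp only: permutes_in_image)
    have "(\<Sum>k\<in>M_columns n. (case k of (i, j) \<Rightarrow> b i j) * M_matrix d k)
        = (\<Sum>(i, j)\<in>{1..n} \<times> {1..n}. if j = d i then b i j else 0)"
    proof (rule sum.mono_neutral_cong_left)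
      show "M_columns n \<subseteq> {1..n} \<times> {1..n}"
        by (auto simp: M_columns_def)
      \<comment> \<open>A derangement never hits the diagonal, and off the diagonal the positions
        outside \<open>M_columns\<close> lie in the last row or column, where \<open>b\<close>
        vanishes.\<close>
      show "\<forall>k\<in>{1..n} \<times> {1..n} - M_columns n. (case k of (i, j) \<Rightarrow> if j = d i then b i j else 0) = 0"
      proof clarify
        fix i j assume ij: "i \<in> {1..n}" "j \<in> {1..n}" "(i, j) \<notin> M_columns n"
        show "(if j = d i then b i j else 0) = 0"
        proof (cases "j = d i")
          case True
          then have "i \<noteq> j"
            using d_neq[OF ij(1)] by simp
          then have "i = n \<or> j = n"
            using ij by (auto simp: M_columns_def)
          then have "b i j = 0"
            using b_row b_col \<open>i \<noteq> j\<close> by auto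
          then show ?thesis
            unfolding True by simp
        qed simp
      qed
    qed (auto simp: M_matrix_def)
    also have "\<dots> = (\<Sum>i\<in>{1..n}. \<Sum>j\<in>{1..n}. if j = d i then b i j else 0)"
      by (rule sum.cartesian_product[symmetric])
    also have "\<dots> = (\<Sum>i\<in>{1..n}. b i (d i))"
      using dn by (intro sum.cong) (auto simp: sum.delta)
    also have "\<dots> = characteristic_vector T d"
      using vT dG by simp
    also have "\<dots> = 0"
      using T(3) d by (auto simp: characteristic_vector_def)
    finally show ?thesis .
  qed
  have off: "b i j = 0" if ij: "i \<in> {1..n}" "j \<in> {1..n}" "i \<noteq> j" for i j
  proof (cases "i = n \<or> j = n")
    case True
    then show ?thesis
      using b_row b_col ij by auto
  next
    case False
    then have "(i, j) \<in> M_columns n"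
      using ij by (auto simp: M_columns_def)
    from full_rank_columns_independent[OF finite_M_columns _ zero this] show ?thesis
      using rank by (simp add: card_M_columns)
  qed
  have diag: "characteristic_vector T \<pi> = (\<Sum>i\<in>{i\<in>{1..n}. \<pi> i = i}. b i i)" if "\<pi> \<in> G" for \<pi>
  proof -
    have pn: "\<pi> i \<in> {1..n}" if "i \<in> {1..n}" for i
      using perm[OF \<open>\<pi> \<in> G\<close>] that by (simp only: permutes_in_image)
    have "(\<Sum>i\<in>{i\<in>{1..n}. \<pi> i = i}. b i i) = (\<Sum>i\<in>{1..n}. b i (\<pi> i))"
      using off[OF _ pn] by (intro sum.mono_neutral_cong_left) force+
    then show ?thesis
      using vT[OF that] by simp
  qed
  have b01: "b k k = 0 \<or> b k k = 1" if k: "k \<in> {1..n}" for k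
  proof -
    obtain g where g: "g \<in> G" "{i\<in>{1..n}. g i = i} = {k}"
      using two_transitive_single_fixed_point[OF fin idG comp perm trans n k] by blast
    then have "characteristic_vector T g = b k k"
      using diag[OF g(1)] by simp
    then show ?thesis
      by (auto simp: characteristic_vector_def split: if_splits)
  qed
  \<comment> \<open>As the diagonal entries are 0 or 1, summing them over a set of points counts its
    members in \<open>K\<close>. At the identity, which fixes every point, the sum is
    \<open>card K\<close>.\<close>
  define K where "K = {k\<in>{1..n}. b k k = 1}"
  have count: "(\<Sum>i\<in>A. b i i) = of_nat (card (A \<inter> K))" if A: "A \<subseteq> {1..n}" for A
  proof -
    have "(\<Sum>i\<in>A. b i i) = (\<Sum>i\<in>A \<inter> K. 1)"
      using A b01[OF subsetD[OF A]] finite_subset[OF A]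
      by (intro sum.mono_neutral_cong_right) (auto simp: K_def)
    then show ?thesis
      by simp
  qed
  have "{i\<in>{1..n}. id i = i} \<inter> K = K"
    by (auto simp: K_def)
  then have "of_nat (card K) = (1 :: complex)"
    using diag[OF idG] count[OF Collect_restrict[of "{1..n}" "\<lambda>i. id i = i"]] T(2)
    by (simp add: characteristic_vector_def)
  then have "card K = 1"
    by simp
  then obtain k where k: "K = {k}"
    using card_1_singletonE by blast
  have kn: "k \<in> {1..n}"
    using k by (auto simp: K_def)
  have "\<pi> \<in> T \<longleftrightarrow> \<pi> k = k" if "\<pi> \<in> G" for \<pi>
  proof -
    have "characteristic_vector T \<pi> = of_nat (card ({i\<in>{1..n}. \<pi> i = i} \<inter> {k}))"
      using diag[OF that] count[OF Collect_restrict[of "{1..n}" "\<lambda>i. \<pi> i = i"]] k by simp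
    moreover have "{i\<in>{1..n}. \<pi> i = i} \<inter> {k} = (if \<pi> k = k then {k} else {})"
      using kn by auto
    ultimately show ?thesis
      by (auto simp: characteristic_vector_def split: if_splits)
  qed
  then have "T = point_stabilizer G k"
    using T(1) by (auto simp: point_stabilizer_def)
  with kn show ?thesis
    by (rule that)
qed

text \<open>The normal form divides by \<open>n - 2\<close>, so degree 2 is treated apart. On two
  points only the identity has a fixed point, so both sides are \<open>{id}\<close>.\<close>

lemma degree_two_derangement_free_is_stabilizer:
  assumes perm: "\<And>g. g \<in> G \<Longrightarrow> g permutes {1..2::nat}"
    and T: "T \<subseteq> G" "id \<in> T" "T \<inter> derangements 2 G = {}"
  shows "T = point_stabilizer G 1"
proof -
  have eq_id: "g = id" if g: "g permutes {1..2::nat}" and i: "i \<in> {1..2}" "g i = i" for g i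
  proof
    fix x
    have set2: "{1..2::nat} = {1, 2}"
      by auto
    have "g 1 \<in> {1, 2}" "g 2 \<in> {1, 2}" "g 1 \<noteq> g 2"
      using permutes_in_image[OF g, of 1] permutes_in_image[OF g, of 2]
        injD[OF permutes_inj[OF g], of 1 2] unfolding set2 by auto
    then have "g 1 = 1" "g 2 = 2"
      using i unfolding set2 by auto
    then show "g x = id x"
      using permutes_not_in[OF g, of x] unfolding set2 by (cases "x \<in> {1, 2}") auto
  qed
  have "g = id" if g: "g \<in> T" for g
  proof -
    have "g \<in> G" "\<exists>i\<in>{1..2}. g i = i"
      using g T(1,3) by (auto simp: derangements_def)
    then show ?thesis
      using eq_id[OF perm] by blast
  qed
  moreover have "g = id" if g: "g \<in> point_stabilizer G 1" for g
  proof -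
    have "g \<in> G" "g 1 = 1"
      using g by (simp_all add: point_stabilizer_def)
    then show ?thesis
      using eq_id[OF perm, of g 1] by simp
  qed
  moreover have "id \<in> point_stabilizer G 1"
    using T(1,2) by (auto simp: point_stabilizer_def)
  ultimately show ?thesis
    using T(2) by blast
qed

theorem theorem6p4:
  fixes n :: nat and G :: "(nat \<Rightarrow> nat) set"
  assumes "subgroup G (sym_group n)"
    and "two_transitive n G"
    and "EKR_property n G"
    and "\<And>S. maximum_intersecting_subset n G S \<Longrightarrow>
           characteristic_vector S \<in> trivial_plus_standard_module n G"
    and "matrix_rank (derangements n G) (M_columns n) M_matrix = (n - 1) * (n - 2)"
  shows "strict_EKR_property n G"
  unfolding strict_EKR_property_def
proof (intro conjI allI impI)
  show "EKR_property n G"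
    by fact
next
  fix S assume S: "maximum_intersecting_subset n G S"
  have n: "2 \<le> n"
    using assms(2) by (simp add: two_transitive_def)
  have perm: "\<pi> permutes {1..n}" if "\<pi> \<in> G" for \<pi>
    using subgroup.subset[OF assms(1)] that by (auto simp: sym_group_carrier)
  have idG: "id \<in> G"
    using subgroup.one_closed[OF assms(1)] by (simp add: sym_group_one)
  have comp: "g \<circ> h \<in> G" if "g \<in> G" "h \<in> G" for g h
    using subgroup.m_closed[OF assms(1) that] by (simp add: sym_group_mult)
  have invG: "inv' g \<in> G" if "g \<in> G" for g
    using subgroup.m_inv_closed[OF assms(1) that] perm[OF that]
    by (simp add: sym_group_inv_equality sym_group_carrier)
  have fin: "finite G"
    by (rule finite_subset[OF _ finite_permutations[of "{1..n}"]]) (use perm in auto)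
  have SG: "S \<subseteq> G" and int: "\<And>\<pi> \<sigma>. \<pi> \<in> S \<Longrightarrow> \<sigma> \<in> S \<Longrightarrow> perms_intersect n \<pi> \<sigma>"
    using S by (auto simp: maximum_intersecting_subset_def intersecting_subset_def)
  \<comment> \<open>Comparison with this singleton shows that \<open>S\<close> is nonempty.\<close>
  have "intersecting_subset n G {id}"
    using idG n by (auto simp: intersecting_subset_def perms_intersect_def)
  then have "card {id :: nat \<Rightarrow> nat} \<le> card S"
    using S unfolding maximum_intersecting_subset_def by blast
  then obtain \<sigma> where \<sigma>: "\<sigma> \<in> S"
    by fastforce
  then have \<sigma>G: "\<sigma> \<in> G" and \<sigma>p: "\<sigma> permutes {1..n}"
    using SG perm by auto
  \<comment> \<open>The right translate of \<open>S\<close> by the inverse of \<sigma>. If \<pi> is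
    in \<open>T\<close>, then \<open>\<pi> \<circ> \<sigma>\<close> and \<sigma> both lie in
    \<open>S\<close>, and their intersecting means that \<pi> has a fixed point.\<close>
  define T where "T = {\<pi>\<in>G. \<pi> \<circ> \<sigma> \<in> S}"
  have TG: "T \<subseteq> G" and idT: "id \<in> T"
    using idG \<sigma> by (auto simp: T_def)
  have T_der: "T \<inter> derangements n G = {}"
  proof -
    have "\<exists>i\<in>{1..n}. \<pi> i = i" if "\<pi> \<in> T" for \<pi>
    proof -
      have "perms_intersect n (\<pi> \<circ> \<sigma>) \<sigma>"
        using that \<sigma> int by (auto simp: T_def)
      then show ?thesis
        using permutes_inverses[OF \<sigma>p] by (auto simp: perms_intersect_def)
    qed
    then show ?thesis
      by (auto simp: derangements_def)
  qed
  have "characteristic_vector S \<in> position_sums n G"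
    using assms(4)[OF S] trivial_plus_standard_module_subset_position_sums[of n G] n perm by auto
  then obtain a where a: "\<forall>\<pi>\<in>G. characteristic_vector S \<pi> = (\<Sum>i\<in>{1..n}. a i (\<pi> i))"
    by (auto simp: position_sums_def)
  \<comment> \<open>Reindexing the positions by \<sigma> shows that \<open>position_sums\<close> is
    preserved by the translation.\<close>
  have "characteristic_vector T \<pi> = (\<Sum>i\<in>{1..n}. a (inv' \<sigma> i) (\<pi> i))" if "\<pi> \<in> G" for \<pi>
  proof -
    have "characteristic_vector T \<pi> = characteristic_vector S (\<pi> \<circ> \<sigma>)"
      using that by (auto simp: characteristic_vector_def T_def)
    also have "\<dots> = (\<Sum>i\<in>{1..n}. a i (\<pi> (\<sigma> i)))"
      using a comp[OF that \<sigma>G] by simp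
    also have "\<dots> = (\<Sum>i\<in>{1..n}. a (inv' \<sigma> i) (\<pi> i))"
      using sum.permute[OF \<sigma>p, of "\<lambda>i. a (inv' \<sigma> i) (\<pi> i)"] permutes_inverses[OF \<sigma>p]
      by (simp add: o_def)
    finally show ?thesis .
  qed
  then have vT: "characteristic_vector T \<in> position_sums n G"
    unfolding position_sums_def mem_Collect_eq
    by (intro exI[of _ "\<lambda>i. a (inv' \<sigma> i)"]) blast
  obtain k where k: "k \<in> {1..n}" and T_eq: "T = point_stabilizer G k"
  proof (cases "n = 2")
    case True
    then show ?thesis
      using degree_two_derangement_free_is_stabilizer[of G T] perm TG idT T_der
      by (intro that[of 1]) auto
  next
    case False
    then have "3 \<le> n"
      using n by simp
    from position_sum_derangement_free_is_stabilizer
      [OF fin idG comp perm assms(2) this assms(5) TG idT T_der vT]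
    show ?thesis
      using that by blast
  qed
  \<comment> \<open>Translating back: \<pi> is in \<open>S\<close> exactly if
    \<open>\<pi> \<circ> inv' \<sigma>\<close> fixes \<open>k\<close>.\<close>
  have "S = {\<pi>\<in>G. \<pi> (inv' \<sigma> k) = k}"
  proof -
    have "\<pi> \<in> S \<longleftrightarrow> \<pi> \<circ> inv' \<sigma> \<in> T" if "\<pi> \<in> G" for \<pi>
      using comp[OF that invG[OF \<sigma>G]] permutes_inv_o(2)[OF \<sigma>p] by (simp add: T_def o_assoc[symmetric])
    then show ?thesis
      using SG comp[OF _ invG[OF \<sigma>G]] by (auto simp: T_eq point_stabilizer_def)
  qed
  moreover have "inv' \<sigma> k \<in> {1..n}"
    using permutes_in_image[OF permutes_inv[OF \<sigma>p]] k by blast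
  ultimately show "\<exists>i\<in>{1..n}. \<exists>j\<in>{1..n}. S = {\<pi>\<in>G. \<pi> i = j}"
    using k by blast
qed

end
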